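(* Let $\mathfrak{g}=(V,[\cdot,\cdot],\alpha)$ be a multiplicative Heisenberg Hom-Lie superalgebra over $\mathbb{C}$ of dimension three which is not a Hom-Lie algebra (i.e. $V_{\bar 1}\neq 0$). Then $\mathfrak{g}$ must be isomorphic to one of the following, where $\mu_0,\mu_{ij}\in\mathbb{C}$ ($i,j=1,2$): (1) $\left(\mathfrak{h}_{1},\begin{pmatrix}\mu_{11}\mu_{22}&0&0\\0&\mu_{11}&0\\0&0&\mu_{22}\end{pmatrix}\right)$ with $\mu_{11}\mu_{22}\neq 0$; (2) $\left(\mathfrak{h}_{1},\begin{pmatrix}\mu_{12}\mu_{21}&0&0\\0&0&\mu_{12}\\0&\mu_{21}&0\end{pmatrix}\right)$ with $\mu_{12}\mu_{21}\neq 0$; (3) $\left(\mathfrak{h}_{1},\begin{pmatrix}0&0&0\\0&\mu_{11}&\mu_{12}\\0&0&0\end{pmatrix}\right)$; (4) $\left(\mathfrak{h}_{2},\begin{pmatrix}\mu_{0}&0&0\\0&\mu_{11}&0\\0&0&\mu_{0}\mu_{11}\end{pmatrix}\right)$; (5) $\left(\mathfrak{h}_{2},\begin{pmatrix}\mu_{0}&0&0\\0&\mu_{11}&0\\0&1&\mu_{11}\end{pmatrix}\right)$ with $(\mu_{0}-1)\mu_{11}=0$.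
   Context: A Hom-Lie superalgebra $\mathfrak{g}=(V,[\cdot,\cdot],\alpha)$ over $\mathbb{C}$ consists of a $\mathbb{Z}_2$-graded vector space $V=V_{\bar 0}\oplus V_{\bar 1}$, an even bilinear map $[\cdot,\cdot]:V\times V\to V$ and an even linear map $\alpha:V\to V$ such that for all homogeneous $x,y,z$: $[x,y]=-(-1)^{|x||y|}[y,x]$ and $\circlearrowleft_{x,y,z}(-1)^{|x||z|}[\alpha(x),[y,z]]=0$ (cyclic sum over $x,y,z$). It is a Hom-Lie algebra when $V_{\bar 1}=0$. It is multiplicative if $\alpha([x,y])=[\alpha(x),\alpha(y)]$ for all $x,y$. Its center is $Z(\mathfrak{g})=\{x\in V:[x,y]=0\ \forall y\in V\}$. Two Hom-Lie superalgebras $(V,[\cdot,\cdot]_1,\alpha)$ and $(V,[\cdot,\cdot]_2,\beta)$ are isomorphic if there is an even bijective linear map $\phi$ with $\phi([x,y]_1)=[\phi(x),\phi(y)]_2$ for all $x,y$ and $\phi\circ\alpha=\beta\circ\phi$. Heisenberg: Let $\mathfrak{g}$ be a finite-dimensional Hom-Lie superalgebra whose derived ideal $[\mathfrak{g},\mathfrak{g}]$ is 1-dimensional, homogeneous and contained in $Z(\mathfrak{g})$, with homogeneous generator $h$. Then $[x,y]=\bar{\mathcal{B}}(x,y)h$ defines a homogeneous skew-supersymmetric bilinear form $\bar{\mathcal{B}}$ on $\mathfrak{g}$, which induces a form $\mathcal{B}$ on $\mathfrak{g}/Z(\mathfrak{g})$ by $\mathcal{B}(x+Z(\mathfrak{g}),y+Z(\mathfrak{g}))=\bar{\mathcal{B}}(x,y)$.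 $\mathfrak{g}$ is called a Heisenberg Hom-Lie superalgebra if $[\mathfrak{g},\mathfrak{g}]$ is generated by a homogeneous element $h\in Z(\mathfrak{g})$ and $\mathcal{B}$ is non-degenerate. $\mathfrak{h}_1$ is the superalgebra with basis $\{h\mid v_1,v_2\}$ ($h$ even, $v_1,v_2$ odd) and bracket $[v_1,v_2]=[v_2,v_1]=h$, all other brackets of basis elements zero. $\mathfrak{h}_2$ is the superalgebra with basis $\{u\mid v,h\}$ ($u$ even, $v,h$ odd) and bracket $[u,v]=-[v,u]=h$, all other brackets of basis elements zero. $(\mathfrak{h}_i,\alpha)$ denotes $\mathfrak{h}_i$ with twisting map $\alpha$. Matrices act on column vectors with respect to the ordered bases $(h,v_1,v_2)$ and $(u,v,h)$ respectively, so columns are the images of the basis vectors.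
   Formalization: The center Z(g) is additionally assumed one-dimensional; without this the claim fails, e.g. for the algebra with h even, v, z odd, only nonzero bracket [v,v]=h and α=id, whose center is two-dimensional, while every listed algebra has a one-dimensional center. *)

theory Defs
  imports "HOL-Analysis.Analysis" "HOL-Library.Z2"
begin

text \<open>
  The underlying space V is the whole type \<open>'a\<close>, with scalar multiplication \<open>scaling\<close>.
  The parities are the elements of the two-element field \<^typ>\<open>bit\<close>, and
  \<open>grading g i\<close> is the homogeneous component of parity \<open>i\<close>.
\<close>

record 'a hom_superalgebra =
  scaling :: "complex \<Rightarrow> 'a \<Rightarrow> 'a"
  grading :: "bit \<Rightarrow> 'a set"
  bracket :: "'a \<Rightarrow> 'a \<Rightarrow> 'a"
  twist :: "'a \<Rightarrow> 'a"

definition super_sign :: "bit \<Rightarrow> bit \<Rightarrow> complex" where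
  "super_sign i j = (if i * j = 1 then -1 else 1)"

definition super_vector_space ::
    "(complex \<Rightarrow> 'a::ab_group_add \<Rightarrow> 'a) \<Rightarrow> (bit \<Rightarrow> 'a set) \<Rightarrow> bool" where
  "super_vector_space s V \<longleftrightarrow>
     vector_space s \<and>
     (\<forall>i. module.subspace s (V i)) \<and>
     V 0 \<inter> V 1 = {0} \<and>
     (\<forall>x. \<exists>x0\<in>V 0. \<exists>x1\<in>V 1. x = x0 + x1)"

definition hom_lie_superalgebra :: "'a::ab_group_add hom_superalgebra \<Rightarrow> bool" where
  "hom_lie_superalgebra g \<longleftrightarrow>
     super_vector_space (scaling g) (grading g) \<and>
     (\<forall>x. Vector_Spaces.linear (scaling g) (scaling g) (\<lambda>y. bracket g x y)) \<and>
     (\<forall>y. Vector_Spaces.linear (scaling g) (scaling g) (\<lambda>x. bracket g x y)) \<and>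
     (\<forall>i j. \<forall>x\<in>grading g i. \<forall>y\<in>grading g j. bracket g x y \<in> grading g (i + j)) \<and>
     Vector_Spaces.linear (scaling g) (scaling g) (twist g) \<and>
     (\<forall>i. \<forall>x\<in>grading g i. twist g x \<in> grading g i) \<and>
     (\<forall>i j. \<forall>x\<in>grading g i. \<forall>y\<in>grading g j.
        bracket g x y = - scaling g (super_sign i j) (bracket g y x)) \<and>
     (\<forall>i j k. \<forall>x\<in>grading g i. \<forall>y\<in>grading g j. \<forall>z\<in>grading g k.
        scaling g (super_sign i k) (bracket g (twist g x) (bracket g y z)) +
        scaling g (super_sign j i) (bracket g (twist g y) (bracket g z x)) +
        scaling g (super_sign k j) (bracket g (twist g z) (bracket g x y)) = 0)"

definition multiplicative :: "'a hom_superalgebra \<Rightarrow> bool" where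
  "multiplicative g \<longleftrightarrow> (\<forall>x y. twist g (bracket g x y) = bracket g (twist g x) (twist g y))"

definition hls_center :: "'a::zero hom_superalgebra \<Rightarrow> 'a set" where
  "hls_center g = {x. \<forall>y. bracket g x y = 0}"

definition derived_ideal :: "'a::ab_group_add hom_superalgebra \<Rightarrow> 'a set" where
  "derived_ideal g = module.span (scaling g) {bracket g x y | x y. True}"

definition hls_isomorphic ::
    "'a::ab_group_add hom_superalgebra \<Rightarrow> 'b::ab_group_add hom_superalgebra \<Rightarrow> bool" where
  "hls_isomorphic g g' \<longleftrightarrow>
     (\<exists>\<phi>. Vector_Spaces.linear (scaling g) (scaling g') \<phi> \<and> bij \<phi> \<and>
          (\<forall>i. \<forall>x\<in>grading g i. \<phi> x \<in> grading g' i) \<and>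
          (\<forall>x y. \<phi> (bracket g x y) = bracket g' (\<phi> x) (\<phi> y)) \<and>
          \<phi> \<circ> twist g = twist g' \<circ> \<phi>)"

text \<open>
  The form is only meaningful when the derived ideal is spanned by \<open>h \<noteq> 0\<close>
  and is contained in the center: then \<open>bar_form g h\<close> is the form given by
  \<open>[x,y] = bar_form g h x y \<cdot> h\<close>, and its values depend only on the classes of the two
  arguments modulo the center, so that \<open>quotient_form g h\<close> is well defined on
  \<open>center_quotient g\<close>, whose elements are the cosets of the center.
\<close>

definition bar_form :: "'a hom_superalgebra \<Rightarrow> 'a \<Rightarrow> 'a \<Rightarrow> 'a \<Rightarrow> complex" where
  "bar_form g h x y = (THE c. bracket g x y = scaling g c h)"

definition center_quotient :: "'a::ab_group_add hom_superalgebra \<Rightarrow> 'a set set" where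
  "center_quotient g = {(+) x ` hls_center g | x. True}"

definition quotient_form :: "'a hom_superalgebra \<Rightarrow> 'a \<Rightarrow> 'a set \<Rightarrow> 'a set \<Rightarrow> complex" where
  "quotient_form g h X Y = (THE c. \<exists>x\<in>X. \<exists>y\<in>Y. c = bar_form g h x y)"

text \<open>
  The form is skew-supersymmetric and homogeneous, so its left and right radicals coincide;
  the zero of the quotient is the coset \<open>hls_center g\<close>.
\<close>

definition nondegenerate_quotient_form :: "'a::ab_group_add hom_superalgebra \<Rightarrow> 'a \<Rightarrow> bool" where
  "nondegenerate_quotient_form g h \<longleftrightarrow>
     (\<forall>X\<in>center_quotient g.
        (\<forall>Y\<in>center_quotient g. quotient_form g h X Y = 0) \<longrightarrow> X = hls_center g)"

text \<open>
  Since \<open>x\<close> is central if and only if \<open>bar_form g h x\<close> vanishes, nondegeneracy modulo the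
  center holds automatically, and the definition does not force the center to be
  one-dimensional. For example, the algebra with basis \<open>h\<close> even, \<open>v, z\<close> odd and only
  nonzero bracket \<open>[v,v] = h\<close> satisfies it, with center spanned by \<open>h\<close> and \<open>z\<close>.
  A statement about Heisenberg algebras in the usual sense, where the center is spanned by
  \<open>h\<close>, has to assume this in addition.
\<close>

definition heisenberg_hom_lie_superalgebra :: "'a::ab_group_add hom_superalgebra \<Rightarrow> bool" where
  "heisenberg_hom_lie_superalgebra g \<longleftrightarrow>
     hom_lie_superalgebra g \<and>
     (\<exists>B. finite B \<and> module.span (scaling g) B = UNIV) \<and>
     (\<exists>h i. h \<noteq> 0 \<and> h \<in> grading g i \<and> h \<in> hls_center g \<and>
            derived_ideal g = module.span (scaling g) {h} \<and>
            nondegenerate_quotient_form g h)"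

text \<open>
  Both model algebras live on \<^typ>\<open>complex^3\<close>: the first coordinate is even and the other
  two are odd. The ordered basis \<open>axis 1 1, axis 2 1, axis 3 1\<close> is \<open>h, v1, v2\<close> for \<open>h1\<close>
  and \<open>u, v, h\<close> for \<open>h2\<close>; the brackets are the bilinear extensions of
  \<open>[v1,v2] = [v2,v1] = h\<close> and of \<open>[u,v] = -[v,u] = h\<close>.
\<close>

definition grading_1_2 :: "bit \<Rightarrow> (complex^3) set" where
  "grading_1_2 i = (if i = 0 then {x. x $ 2 = 0 \<and> x $ 3 = 0} else {x. x $ 1 = 0})"

definition h1 :: "complex^3^3 \<Rightarrow> (complex^3) hom_superalgebra" where
  "h1 A = \<lparr>scaling = (*s), grading = grading_1_2,
           bracket = (\<lambda>x y. axis 1 (x $ 2 * y $ 3 + x $ 3 * y $ 2)),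
           twist = (\<lambda>x. A *v x)\<rparr>"

definition h2 :: "complex^3^3 \<Rightarrow> (complex^3) hom_superalgebra" where
  "h2 A = \<lparr>scaling = (*s), grading = grading_1_2,
           bracket = (\<lambda>x y. axis 3 (x $ 1 * y $ 2 - x $ 2 * y $ 1)),
           twist = (\<lambda>x. A *v x)\<rparr>"

text \<open>The matrix with the given three rows, as displayed.\<close>

abbreviation mat3 ::
    "'a \<Rightarrow> 'a \<Rightarrow> 'a \<Rightarrow> 'a \<Rightarrow> 'a \<Rightarrow> 'a \<Rightarrow> 'a \<Rightarrow> 'a \<Rightarrow> 'a \<Rightarrow> ('a::zero)^3^3" where
  "mat3 a b c d e f p q r \<equiv>
     vector [vector [a, b, c], vector [d, e, f], vector [p, q, r]]"

end

theory Submission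
  imports Defs
begin

text \<open>
  The generator \<open>h\<close> of the derived ideal is homogeneous and spans the center, so the bracket is
  \<open>[x, y] = B(x, y) h\<close> with a form \<open>B\<close> whose radical is the line of \<open>h\<close>. The bracket is determined
  up to isomorphism by the parity of \<open>h\<close>: in each case there is a homogeneous basis in which \<open>B\<close> has a normal form,
  and multiplicativity of the twist \<open>\<alpha>\<close> becomes a few polynomial equations on its matrix.

  Suppose that \<open>h\<close> is even. The form vanishes between even and odd vectors, because such a bracket
  is odd. It is alternating on the even part, so if it were nonzero there, then \<open>h\<close> and a
  hyperbolic pair would span an even space of dimension three, and there would be no odd vectors
  (\<open>bracket_even_even\<close>). Hence the even part is the line of \<open>h\<close>, and \<open>B\<close> is a nondegenerate
  symmetric form on the two-dimensional odd part. Over the complex numbers it has an isotropic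
  basis \<open>v, w\<close> with \<open>[v, w] = h\<close> (\<open>hyperbolic_pair\<close>). If \<open>\<alpha> v = a v + c w\<close> and
  \<open>\<alpha> w = b v + d w\<close>, then applying \<open>\<alpha>\<close> to \<open>[v, v] = [w, w] = 0\<close> and to \<open>[v, w] = h\<close> yields
  \<open>a c = 0\<close>, \<open>b d = 0\<close> and \<open>\<alpha> h = (a d + b c) h\<close>. The solutions are the diagonal matrices, the
  antidiagonal ones, and those with at most one nonzero row; exchanging \<open>v\<close> and \<open>w\<close> moves that row
  to the top.

  Suppose that \<open>h\<close> is odd. Only brackets of an even with an odd vector survive, so there are
  \<open>u\<close> even and \<open>v\<close> odd with \<open>[u, v] = h\<close>, and \<open>u, v, h\<close> is a basis. Here \<open>\<alpha> u = m u\<close>,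
  \<open>\<alpha> v = a v + b h\<close> and, by multiplicativity, \<open>\<alpha> h = m a h\<close>. Replacing \<open>v\<close> by \<open>v + t h\<close> changes
  \<open>b\<close> to \<open>b + t (m - 1) a\<close>, which removes \<open>b\<close> unless \<open>(m - 1) a = 0\<close>. In that exceptional case a
  nonzero \<open>b\<close> is normalised to \<open>1\<close> by scaling \<open>u\<close> and \<open>h\<close>.
\<close>

section \<open>Linear algebra\<close>

lemma (in vector_space) finite_spanning_imp_finite_dimensional:
  assumes "finite B0" "span B0 = UNIV"
  obtains B where "finite_dimensional_vector_space scale B"
proof -
  obtain B where B: "B \<subseteq> B0" "independent B" "B0 \<subseteq> span B"
    by (rule maximal_independent_subset)
  have "span B = UNIV" using B assms(2) by (metis span_mono span_span top.extremum_uniqueI)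
  then have "finite_dimensional_vector_space scale B"
    using B assms(1) by unfold_locales (auto intro: finite_subset)
  then show thesis by (rule that)
qed

lemma linear_bij_inv:
  assumes "Vector_Spaces.linear s1 s2 f" and "bij f"
  shows "Vector_Spaces.linear s2 s1 (inv f)"
proof -
  interpret f: Vector_Spaces.linear s1 s2 f by fact
  have inj: "inj f" and surj: "surj f"
    using assms(2) by (auto simp: bij_def)
  have "inv f (x + y) = inv f x + inv f y" for x y
    by (rule inv_f_eq[OF inj]) (simp add: f.add surj_f_inv_f[OF surj])
  moreover have "inv f (s2 c x) = s1 c (inv f x)" for c x
    by (rule inv_f_eq[OF inj]) (simp add: f.scale surj_f_inv_f[OF surj])
  ultimately show ?thesis
    using f.vs1.vector_space_axioms f.vs2.vector_space_axioms
    by (simp add: Vector_Spaces.linear_iff)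
qed

section \<open>Isomorphisms and the model space\<close>

text \<open>
  A parity-preserving bijection has a parity-preserving inverse because the components of a
  vector are mapped to the components of its image. This permits building isomorphisms in the
  convenient direction, from the coordinate space to the algebra.
\<close>
lemma hls_isomorphic_sym:
  assumes g: "super_vector_space (scaling g) (grading g)"
    and g': "super_vector_space (scaling g') (grading g')"
    and iso: "hls_isomorphic g g'"
  shows "hls_isomorphic g' g"
proof -
  obtain \<phi> where lin: "Vector_Spaces.linear (scaling g) (scaling g') \<phi>" and bij: "bij \<phi>"
    and even: "\<And>i x. x \<in> grading g i \<Longrightarrow> \<phi> x \<in> grading g' i"
    and br: "\<And>x y. \<phi> (bracket g x y) = bracket g' (\<phi> x) (\<phi> y)"
    and tw: "\<phi> \<circ> twist g = twist g' \<circ> \<phi>"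
    using iso unfolding hls_isomorphic_def by blast
  interpret \<phi>: Vector_Spaces.linear "scaling g" "scaling g'" \<phi> by fact
  have inj: "inj \<phi>" and inv: "\<phi> (inv \<phi> y) = y" for y
    using bij by (auto simp: bij_def surj_f_inv_f)
  have sub: "module.subspace (scaling g') (grading g' i)" for i
    using g' by (simp add: super_vector_space_def)
  have disj: "z = 0" if "z \<in> grading g' 0" "z \<in> grading g' 1" for z
    using g' that by (auto simp: super_vector_space_def)
  have "inv \<phi> y \<in> grading g i" if y: "y \<in> grading g' i" for i y
  proof -
    obtain x0 x1 where x: "x0 \<in> grading g 0" "x1 \<in> grading g 1" "inv \<phi> y = x0 + x1"
      using g unfolding super_vector_space_def by blast
    have sum: "y = \<phi> x0 + \<phi> x1"
      using inv[of y] x(3) by (simp add: \<phi>.add)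
    note hom = even[OF x(1)] even[OF x(2)]
    show ?thesis
    proof (cases "i = 0")
      case i0: True
      have "\<phi> x1 = y - \<phi> x0" using sum by simp
      then have "\<phi> x1 \<in> grading g' 0"
        using y i0 hom(1) by (simp add: \<phi>.vs2.subspace_diff[OF sub])
      then have "\<phi> x1 = \<phi> 0" using disj hom(2) by (simp add: \<phi>.zero)
      then have "x1 = 0" by (rule injD[OF inj])
      then show ?thesis using x i0 by simp
    next
      case False
      then have i1: "i = 1" by simp
      have "\<phi> x0 = y - \<phi> x1" using sum by simp
      then have "\<phi> x0 \<in> grading g' 1"
        using y i1 hom(2) by (simp add: \<phi>.vs2.subspace_diff[OF sub])
      then have "\<phi> x0 = \<phi> 0" using disj hom(1) by (simp add: \<phi>.zero)
      then have "x0 = 0" by (rule injD[OF inj])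
      then show ?thesis using x i1 by simp
    qed
  qed
  moreover have "inv \<phi> (bracket g' x y) = bracket g (inv \<phi> x) (inv \<phi> y)" for x y
    by (rule inv_f_eq[OF inj]) (simp add: br inv)
  moreover have "inv \<phi> (twist g' y) = twist g (inv \<phi> y)" for y
    by (rule inv_f_eq[OF inj]) (use fun_cong[OF tw, of "inv \<phi> y"] in \<open>simp add: inv\<close>)
  ultimately show ?thesis
    unfolding hls_isomorphic_def
    using linear_bij_inv[OF lin bij] bij_imp_bij_inv[OF bij] by (intro exI[of _ "inv \<phi>"]) auto
qed

lemma super_vector_space_complex3: "super_vector_space (*s) grading_1_2"
proof -
  have "vec.subspace (grading_1_2 i)" for i
    by (auto simp: vec.subspace_def grading_1_2_def)
  moreover have "grading_1_2 0 \<inter> grading_1_2 1 = {0}"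
    by (auto simp: grading_1_2_def vec_eq_iff forall_3)
  moreover have "\<exists>x0\<in>grading_1_2 0. \<exists>x1\<in>grading_1_2 1. x = x0 + x1" for x
    by (rule bexI[of _ "vector [x $ 1, 0, 0]"], rule bexI[of _ "vector [0, x $ 2, x $ 3]"])
      (auto simp: grading_1_2_def vec_eq_iff forall_3)
  ultimately show ?thesis
    by (simp add: super_vector_space_def vec.vector_space_axioms)
qed

lemma mat3_mult_vec:
  fixes x :: "complex^3"
  shows "mat3 a b c d e f p q r *v x =
    vector [a * x$1 + b * x$2 + c * x$3, d * x$1 + e * x$2 + f * x$3, p * x$1 + q * x$2 + r * x$3]"
  by (simp add: vec_eq_iff forall_3 matrix_vector_mult_def sum_3)

section \<open>Three-dimensional Heisenberg superalgebras\<close>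

text \<open>
  Nondegeneracy of the form modulo the line of \<open>h\<close> enters as the equation \<open>center\<close>: the radical
  of the form is exactly the line of \<open>h\<close>. The parity of \<open>h\<close> is left open, so that the two cases
  of the classification share this setting.
\<close>
locale heisenberg_superalgebra_dim3 =
  fixes g :: "'a::ab_group_add hom_superalgebra" and h :: 'a
  assumes hom_lie: "hom_lie_superalgebra g"
    and multiplicative: "multiplicative g"
    and finite_dimensional: "\<exists>B. finite B \<and> module.span (scaling g) B = UNIV"
    and dim_3: "vector_space.dim (scaling g) (UNIV :: 'a set) = 3"
    and odd_part_nonzero: "grading g 1 \<noteq> {0}"
    and h_nonzero: "h \<noteq> 0"
    and center: "hls_center g = module.span (scaling g) {h}"
    and derived: "derived_ideal g = module.span (scaling g) {h}"
begin

abbreviation scale_g (infixr "\<odot>" 75) where "c \<odot> x \<equiv> scaling g c x"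
abbreviation bracket_g ("\<langle>_, _\<rangle>") where "\<langle>x, y\<rangle> \<equiv> bracket g x y"
abbreviation "even_part \<equiv> grading g 0"
abbreviation "odd_part \<equiv> grading g 1"

lemma super_vector_space_g: "super_vector_space (scaling g) (grading g)"
  using hom_lie unfolding hom_lie_superalgebra_def by blast

sublocale vector_space "scaling g"
  using super_vector_space_g by (simp add: super_vector_space_def)

sublocale tw: Vector_Spaces.linear "scaling g" "scaling g" "twist g"
  using hom_lie unfolding hom_lie_superalgebra_def by blast

lemma bracket_linear:
  shows bracket_linear_right: "Vector_Spaces.linear (scaling g) (scaling g) (\<lambda>y. \<langle>x, y\<rangle>)"
    and bracket_linear_left: "Vector_Spaces.linear (scaling g) (scaling g) (\<lambda>x. \<langle>x, y\<rangle>)"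
  using hom_lie unfolding hom_lie_superalgebra_def by blast+

lemma bracket_simps:
  "\<langle>x + x', y\<rangle> = \<langle>x, y\<rangle> + \<langle>x', y\<rangle>" "\<langle>x, y + y'\<rangle> = \<langle>x, y\<rangle> + \<langle>x, y'\<rangle>"
  "\<langle>c \<odot> x, y\<rangle> = c \<odot> \<langle>x, y\<rangle>" "\<langle>x, c \<odot> y\<rangle> = c \<odot> \<langle>x, y\<rangle>"
  "\<langle>0, y\<rangle> = 0" "\<langle>x, 0\<rangle> = 0"
  using bracket_linear_right[of x] bracket_linear_left[of y]
  by (simp_all add: Vector_Spaces.linear_iff)
    (metis add_cancel_right_right)+

lemma twist_bracket: "twist g \<langle>x, y\<rangle> = \<langle>twist g x, twist g y\<rangle>"
  using multiplicative by (simp add: multiplicative_def)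

lemma subspace_grading: "subspace (grading g i)"
  using super_vector_space_g by (simp add: super_vector_space_def)

lemma homogeneous_decomposition:
  obtains x0 x1 where "x0 \<in> even_part" "x1 \<in> odd_part" "x = x0 + x1"
  using super_vector_space_g unfolding super_vector_space_def by blast

lemma bracket_grading: "x \<in> grading g i \<Longrightarrow> y \<in> grading g j \<Longrightarrow> \<langle>x, y\<rangle> \<in> grading g (i + j)"
  using hom_lie unfolding hom_lie_superalgebra_def by blast

lemma twist_grading: "x \<in> grading g i \<Longrightarrow> twist g x \<in> grading g i"
  using hom_lie unfolding hom_lie_superalgebra_def by blast

lemma even_odd_zero: "x \<in> even_part \<Longrightarrow> x \<in> odd_part \<Longrightarrow> x = 0"
  using super_vector_space_g by (auto simp: super_vector_space_def)

lemma even_plus_odd_eq_0: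
  assumes "x \<in> even_part" "y \<in> odd_part" "x + y = 0"
  shows "x = 0" "y = 0"
proof -
  have "x = - y" using assms(3) by (simp add: eq_neg_iff_add_eq_0)
  then have "x \<in> odd_part" using assms(2) subspace_neg[OF subspace_grading] by simp
  then show "x = 0" using assms(1) even_odd_zero by simp
  then show "y = 0" using assms(3) by simp
qed

lemma bracket_swap:
  assumes "x \<in> grading g i" "y \<in> grading g j"
  shows "\<langle>x, y\<rangle> = - (super_sign i j \<odot> \<langle>y, x\<rangle>)"
  using hom_lie assms unfolding hom_lie_superalgebra_def by blast

lemma bracket_odd_commute: "x \<in> odd_part \<Longrightarrow> y \<in> odd_part \<Longrightarrow> \<langle>x, y\<rangle> = \<langle>y, x\<rangle>"
  using bracket_swap[of x 1 y 1] by (simp add: super_sign_def scale_minus_left)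

lemma bracket_even_anticommute: "x \<in> even_part \<Longrightarrow> y \<in> grading g i \<Longrightarrow> \<langle>x, y\<rangle> = - \<langle>y, x\<rangle>"
  using bracket_swap[of x 0 y i] by (simp add: super_sign_def)

lemma bracket_even_self: "x \<in> even_part \<Longrightarrow> \<langle>x, x\<rangle> = 0"
proof -
  assume "x \<in> even_part"
  then have "\<langle>x, x\<rangle> + \<langle>x, x\<rangle> = 0"
    by (intro eq_neg_iff_add_eq_0[THEN iffD1] bracket_even_anticommute)
  then have "2 \<odot> \<langle>x, x\<rangle> = 0"
    by (metis one_add_one scale_left_distrib scale_one)
  then show ?thesis by simp
qed

lemma bracket_multiple_of_h: obtains c where "\<langle>x, y\<rangle> = c \<odot> h"
proof -
  have "\<langle>x, y\<rangle> \<in> span {\<langle>x, y\<rangle> | x y. True}" by (rule span_base) blast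
  then show thesis using derived that by (auto simp: derived_ideal_def span_singleton)
qed

lemma central_iff: "(\<forall>y. \<langle>x, y\<rangle> = 0) \<longleftrightarrow> (\<exists>c. x = c \<odot> h)"
proof -
  have "(\<forall>y. \<langle>x, y\<rangle> = 0) \<longleftrightarrow> x \<in> span {h}"
    using center by (auto simp: hls_center_def)
  then show ?thesis by (auto simp: span_singleton)
qed

lemma bracket_h_left: "\<langle>h, y\<rangle> = 0"
  using central_iff[of h] scale_one[of h] by metis

text \<open>Skew-supersymmetry transfers centrality to the other side for homogeneous vectors.\<close>
lemma central_left_imp_right:
  assumes "\<And>y. \<langle>x, y\<rangle> = 0" "x \<in> grading g i" shows "\<langle>y, x\<rangle> = 0"
proof -
  obtain y0 y1 where y: "y0 \<in> even_part" "y1 \<in> odd_part" "y = y0 + y1"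
    by (rule homogeneous_decomposition)
  show ?thesis
    using bracket_swap[OF y(1) assms(2)] bracket_swap[OF y(2) assms(2)] assms(1)
    by (simp add: y(3) bracket_simps)
qed

lemma nonzero_bracket: "\<exists>x y. \<langle>x, y\<rangle> \<noteq> 0"
proof (rule ccontr)
  assume "\<not> ?thesis"
  then have "{\<langle>x, y\<rangle> | x y. True} = {0}" by auto
  then have "span {h} = {0}" using derived by (simp add: derived_ideal_def)
  then show False using h_nonzero span_base[of h "{h}"] by auto
qed

section \<open>Homogeneous bases and coordinates\<close>

definition lincomb3 :: "'a \<Rightarrow> 'a \<Rightarrow> 'a \<Rightarrow> complex^3 \<Rightarrow> 'a" where
  "lincomb3 x y z c = (c $ 1) \<odot> x + (c $ 2) \<odot> y + (c $ 3) \<odot> z"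

lemma linear_lincomb3: "Vector_Spaces.linear (*s) (scaling g) (lincomb3 x y z)"
  by (simp add: Vector_Spaces.linear_iff vec.vector_space_axioms vector_space_axioms lincomb3_def
      scale_left_distrib scale_right_distrib algebra_simps)

lemma bij_lincomb3:
  assumes indep: "\<And>a b c. a \<odot> x + b \<odot> y + c \<odot> z = 0 \<Longrightarrow> a = 0 \<and> b = 0 \<and> c = 0"
  shows "bij (lincomb3 x y z)"
proof -
  let ?\<psi> = "lincomb3 x y z"
  interpret \<psi>: Vector_Spaces.linear "(*s)" "scaling g" ?\<psi> by (rule linear_lincomb3)
  have inj: "inj ?\<psi>"
    unfolding \<psi>.inj_iff_eq_0 using indep by (auto simp: lincomb3_def vec_eq_iff forall_3)
  obtain B where "finite_dimensional_vector_space (scaling g) B"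
    using finite_spanning_imp_finite_dimensional finite_dimensional by blast
  then interpret V: finite_dimensional_vector_space "scaling g" B .
  interpret finite_dimensional_vector_space_pair_1 "(*s)" cart_basis "scaling g" ..
  have "dim (range ?\<psi>) = vec.dim (UNIV :: (complex^3) set)"
    by (rule dim_image_eq[OF linear_lincomb3]) (use inj in \<open>simp\<close>)
  then have "dim (range ?\<psi>) = V.dimension"
    using dim_3 by (simp add: vec_dim_card card_cart_basis V.dimension_def)
  then have "span (range ?\<psi>) = UNIV" using V.dim_eq_full by blast
  then show ?thesis using inj by (simp add: bij_def \<psi>.span_image)
qed

lemma basis_expansion:
  assumes "bij (lincomb3 x y z)"
  obtains a b c where "v = a \<odot> x + b \<odot> y + c \<odot> z"
  using bij_is_surj[OF assms, THEN surjD, of v] by (auto simp: lincomb3_def)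

text \<open>
  To identify the algebra with a model, it suffices to exhibit a homogeneous basis with one even
  and two odd vectors whose brackets and twists are those of the model.
\<close>
lemma isomorphic_by_basis:
  assumes "scaling g' = (*s)" "grading g' = grading_1_2"
    and "bij (lincomb3 b1 b2 b3)"
    and "b1 \<in> even_part" "b2 \<in> odd_part" "b3 \<in> odd_part"
    and "\<And>x y. lincomb3 b1 b2 b3 (bracket g' x y) = \<langle>lincomb3 b1 b2 b3 x, lincomb3 b1 b2 b3 y\<rangle>"
    and "\<And>x. lincomb3 b1 b2 b3 (twist g' x) = twist g (lincomb3 b1 b2 b3 x)"
  shows "hls_isomorphic g g'"
proof (rule hls_isomorphic_sym)
  show "super_vector_space (scaling g) (grading g)" by (rule super_vector_space_g)
  show "super_vector_space (scaling g') (grading g')"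
    using assms super_vector_space_complex3 by simp
  have "lincomb3 b1 b2 b3 x \<in> grading g i" if "x \<in> grading_1_2 i" for i x
    using that assms(4-6)
    by (cases i) (auto simp: grading_1_2_def lincomb3_def
        intro!: subspace_add[OF subspace_grading] subspace_scale[OF subspace_grading])
  then show "hls_isomorphic g' g"
    unfolding hls_isomorphic_def using assms linear_lincomb3
    by (intro exI[of _ "lincomb3 b1 b2 b3"]) auto
qed


lemma isomorphic_to_h1:
  assumes "h \<in> even_part" "v \<in> odd_part" "w \<in> odd_part" "bij (lincomb3 h v w)"
    and brackets: "\<langle>v, v\<rangle> = 0" "\<langle>w, w\<rangle> = 0" "\<langle>v, w\<rangle> = h"
    and twists: "twist g h = l \<odot> h" "twist g v = a \<odot> v + c \<odot> w" "twist g w = b \<odot> v + d \<odot> w"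
  shows "hls_isomorphic g (h1 (mat3 l 0 0 0 a b 0 c d))"
proof (rule isomorphic_by_basis[OF _ _ assms(4,1-3)])
  have "\<langle>w, v\<rangle> = h"
    using brackets(3) bracket_odd_commute[OF assms(2,3)] by simp
  moreover have "\<langle>y, h\<rangle> = 0" for y
    by (rule central_left_imp_right[OF bracket_h_left assms(1)])
  ultimately show "lincomb3 h v w (bracket (h1 (mat3 l 0 0 0 a b 0 c d)) x y)
      = \<langle>lincomb3 h v w x, lincomb3 h v w y\<rangle>" for x y
    by (simp add: h1_def lincomb3_def axis_def bracket_simps brackets bracket_h_left
        scale_left_distrib mult.commute)
  show "lincomb3 h v w (twist (h1 (mat3 l 0 0 0 a b 0 c d)) x) = twist g (lincomb3 h v w x)" for x
    by (simp add: h1_def lincomb3_def mat3_mult_vec tw.add tw.scale twists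
        scale_left_distrib scale_right_distrib algebra_simps)
qed (simp_all add: h1_def)

text \<open>
  The third basis vector \<open>z\<close> need not be \<open>h\<close> itself: rescaling the central generator is what
  normalises the off-diagonal entry of the twist.
\<close>
lemma isomorphic_to_h2:
  assumes "u \<in> even_part" "v \<in> odd_part" "z \<in> odd_part" "bij (lincomb3 u v z)"
    and brackets: "\<langle>u, v\<rangle> = z" "\<langle>v, v\<rangle> = 0" "\<And>y. \<langle>z, y\<rangle> = 0"
    and twists: "twist g u = m \<odot> u" "twist g v = a \<odot> v + b \<odot> z" "twist g z = l \<odot> z"
  shows "hls_isomorphic g (h2 (mat3 m 0 0 0 a 0 0 b l))"
proof (rule isomorphic_by_basis[OF _ _ assms(4,1-3)])
  have "\<langle>v, u\<rangle> = - z"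
    using brackets(1) bracket_even_anticommute[OF assms(1,2)] by (metis minus_minus)
  moreover have "\<langle>u, u\<rangle> = 0" by (rule bracket_even_self[OF assms(1)])
  moreover have "\<langle>y, z\<rangle> = 0" for y
    by (rule central_left_imp_right[OF brackets(3) assms(3)])
  ultimately show "lincomb3 u v z (bracket (h2 (mat3 m 0 0 0 a 0 0 b l)) x y)
      = \<langle>lincomb3 u v z x, lincomb3 u v z y\<rangle>" for x y
    by (simp add: h2_def lincomb3_def axis_def bracket_simps brackets
        scale_left_diff_distrib mult.commute scale_minus_right)
  show "lincomb3 u v z (twist (h2 (mat3 m 0 0 0 a 0 0 b l)) x) = twist g (lincomb3 u v z x)" for x
    by (simp add: h2_def lincomb3_def mat3_mult_vec tw.add tw.scale twists
        scale_left_distrib scale_right_distrib algebra_simps)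
qed (simp_all add: h2_def)

lemma homogeneous_expansion:
  assumes "bij (lincomb3 b1 b2 b3)" "b1 \<in> even_part" "b2 \<in> odd_part" "b3 \<in> odd_part"
  shows even_expansion: "x \<in> even_part \<Longrightarrow> \<exists>a. x = a \<odot> b1"
    and odd_expansion: "x \<in> odd_part \<Longrightarrow> \<exists>b c. x = b \<odot> b2 + c \<odot> b3"
proof -
  obtain a b c where abc: "x = a \<odot> b1 + b \<odot> b2 + c \<odot> b3"
    by (rule basis_expansion[OF assms(1)])
  have e: "a \<odot> b1 \<in> even_part" and o: "b \<odot> b2 + c \<odot> b3 \<in> odd_part"
    using assms by (auto intro!: subspace_add[OF subspace_grading] subspace_scale[OF subspace_grading])
  show "\<exists>a. x = a \<odot> b1" if "x \<in> even_part"
  proof -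
    have "a \<odot> b1 - x \<in> even_part" using e that by (rule subspace_diff[OF subspace_grading])
    moreover have "(a \<odot> b1 - x) + (b \<odot> b2 + c \<odot> b3) = 0" by (simp add: abc)
    ultimately have "a \<odot> b1 - x = 0" by (rule even_plus_odd_eq_0(1)[OF _ o])
    then show ?thesis by (metis eq_iff_diff_eq_0)
  qed
  show "\<exists>b c. x = b \<odot> b2 + c \<odot> b3" if "x \<in> odd_part"
  proof -
    have "b \<odot> b2 + c \<odot> b3 - x \<in> odd_part" using o that by (rule subspace_diff[OF subspace_grading])
    moreover have "a \<odot> b1 + (b \<odot> b2 + c \<odot> b3 - x) = 0" by (simp add: abc algebra_simps)
    ultimately have "b \<odot> b2 + c \<odot> b3 - x = 0" by (rule even_plus_odd_eq_0(2)[OF e])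
    then show ?thesis by (metis eq_iff_diff_eq_0)
  qed
qed

lemma bracket_normalise:
  assumes "\<langle>x, y\<rangle> \<noteq> 0" "y \<in> grading g i"
  obtains y' where "y' \<in> grading g i" "\<langle>x, y'\<rangle> = h"
proof -
  obtain c where c: "\<langle>x, y\<rangle> = c \<odot> h" by (rule bracket_multiple_of_h)
  then have "c \<noteq> 0" using assms(1) by auto
  then have "\<langle>x, (1 / c) \<odot> y\<rangle> = h" by (simp add: bracket_simps c)
  moreover have "(1 / c) \<odot> y \<in> grading g i"
    by (rule subspace_scale[OF subspace_grading assms(2)])
  ultimately show thesis using that by blast
qed

text \<open>
  The bracket is a multiple of \<open>h\<close> and also lies in the component \<open>i + j\<close>, and the two components
  meet only in zero.
\<close>
lemma bracket_wrong_parity: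
  assumes "h \<in> grading g k" "x \<in> grading g i" "y \<in> grading g j" "i + j \<noteq> k"
  shows "\<langle>x, y\<rangle> = 0"
proof -
  obtain c where c: "\<langle>x, y\<rangle> = c \<odot> h" by (rule bracket_multiple_of_h)
  have "\<langle>x, y\<rangle> \<in> grading g (i + j)" by (rule bracket_grading[OF assms(2,3)])
  moreover have "\<langle>x, y\<rangle> \<in> grading g k"
    unfolding c by (rule subspace_scale[OF subspace_grading assms(1)])
  ultimately show ?thesis
    using assms(4) even_odd_zero by (cases "i + j"; cases k) (auto simp del: add_bit_eq_xor)
qed

section \<open>Even central generator\<close>

text \<open>
  A nonzero bracket of even vectors \<open>x, y'\<close> would make \<open>h, x, y'\<close> independent, since the
  coefficients of \<open>x\<close> and \<open>y'\<close> are recovered by pairing with the other vector. These would then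
  form a basis of the algebra, which would have no nonzero odd vector.
\<close>
lemma bracket_even_even:
  assumes h: "h \<in> even_part" and x: "x \<in> even_part" "y \<in> even_part"
  shows "\<langle>x, y\<rangle> = 0"
proof (rule ccontr)
  assume "\<langle>x, y\<rangle> \<noteq> 0"
  then obtain y' where y': "y' \<in> even_part" "\<langle>x, y'\<rangle> = h"
    using bracket_normalise x(2) by blast
  have z: "\<langle>x, x\<rangle> = 0" "\<langle>y', y'\<rangle> = 0" "\<langle>x, h\<rangle> = 0"
    using bracket_even_self x y' central_left_imp_right[OF bracket_h_left h] by auto
  have "bij (lincomb3 h x y')"
  proof (rule bij_lincomb3)
    fix a b c assume eq: "a \<odot> h + b \<odot> x + c \<odot> y' = 0"
    have "\<langle>x, a \<odot> h + b \<odot> x + c \<odot> y'\<rangle> = c \<odot> h"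
      by (simp add: bracket_simps z y')
    moreover have "\<langle>a \<odot> h + b \<odot> x + c \<odot> y', y'\<rangle> = b \<odot> h"
      by (simp add: bracket_simps z y' bracket_h_left)
    ultimately have "b = 0" "c = 0"
      unfolding eq by (simp_all add: bracket_simps h_nonzero)
    then show "a = 0 \<and> b = 0 \<and> c = 0" using eq h_nonzero by simp
  qed
  then have "v \<in> even_part" for v
    by (rule basis_expansion[of _ _ _ v])
      (auto intro!: subspace_add[OF subspace_grading] subspace_scale[OF subspace_grading] h x y')
  then show False
    using odd_part_nonzero even_odd_zero subspace_0[OF subspace_grading, of 1] by blast
qed

text \<open>
  A nonzero odd vector is not a multiple of the even \<open>h\<close>, hence not central, and only the odd
  component of a partner contributes to the bracket.
\<close>
lemma odd_pairing:
  assumes h: "h \<in> even_part" and x: "x \<in> odd_part" "x \<noteq> 0"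
  obtains y where "y \<in> odd_part" "\<langle>x, y\<rangle> = h"
proof -
  have "x \<noteq> c \<odot> h" for c
    using x even_odd_zero subspace_scale[OF subspace_grading h] by metis
  then obtain y where y: "\<langle>x, y\<rangle> \<noteq> 0" using central_iff by blast
  obtain y0 y1 where y01: "y0 \<in> even_part" "y1 \<in> odd_part" "y = y0 + y1"
    by (rule homogeneous_decomposition)
  have "\<langle>x, y0\<rangle> = 0" using bracket_wrong_parity[OF h x(1) y01(1)] by simp
  then have "\<langle>x, y1\<rangle> \<noteq> 0" using y by (simp add: y01(3) bracket_simps)
  then show thesis using bracket_normalise y01(2) that by blast
qed

text \<open>
  Even vectors are central, hence multiples of \<open>h\<close>. If the odd part were a line as well, the
  algebra would have dimension at most two.
\<close>
lemma two_odd_vectors: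
  assumes h: "h \<in> even_part"
  obtains w1 w2 where "w1 \<in> odd_part" "w1 \<noteq> 0" "w2 \<in> odd_part" "\<And>c. w2 \<noteq> c \<odot> w1"
proof -
  obtain w1 where w1: "w1 \<in> odd_part" "w1 \<noteq> 0"
    using odd_part_nonzero subspace_0[OF subspace_grading, of 1] by blast
  have "\<exists>w2\<in>odd_part. \<forall>c. w2 \<noteq> c \<odot> w1"
  proof (rule ccontr)
    assume neg: "\<not> ?thesis"
    have "x \<in> span {h, w1}" for x
    proof -
      obtain x0 x1 where x: "x0 \<in> even_part" "x1 \<in> odd_part" "x = x0 + x1"
        by (rule homogeneous_decomposition)
      have "\<langle>x0, y\<rangle> = 0" for y
      proof -
        obtain y0 y1 where y: "y0 \<in> even_part" "y1 \<in> odd_part" "y = y0 + y1"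
          by (rule homogeneous_decomposition)
        show ?thesis
          using bracket_even_even[OF h x(1) y(1)] bracket_wrong_parity[OF h x(1) y(2)]
          by (simp add: y(3) bracket_simps)
      qed
      then obtain c where "x0 = c \<odot> h" using central_iff by blast
      moreover obtain d where "x1 = d \<odot> w1" using neg x(2) by blast
      ultimately show ?thesis
        unfolding x(3) by (auto intro: span_add span_scale span_base)
    qed
    then have "dim UNIV \<le> card {h, w1}" by (intro dim_le_card) auto
    also have "\<dots> \<le> 2" by (simp add: card_insert_if)
    finally show False using dim_3 by simp
  qed
  then show thesis using that w1 by blast
qed

text \<open>
  On the vectors \<open>t w1 + w2\<close>, which are nonzero when \<open>w1, w2\<close> are independent, the form is a
  quadratic polynomial in \<open>t\<close>, and this has a complex root unless its leading coefficient
  \<open>B(w1, w1)\<close> vanishes; but then \<open>w1\<close> itself is isotropic.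
\<close>
lemma isotropic_odd_vector:
  assumes h: "h \<in> even_part"
  obtains v where "v \<in> odd_part" "v \<noteq> 0" "\<langle>v, v\<rangle> = 0"
proof -
  obtain w1 w2 where w: "w1 \<in> odd_part" "w1 \<noteq> 0" "w2 \<in> odd_part" "\<And>c. w2 \<noteq> c \<odot> w1"
    using two_odd_vectors[OF h] by blast
  obtain p q r where pqr: "\<langle>w1, w1\<rangle> = p \<odot> h" "\<langle>w1, w2\<rangle> = q \<odot> h" "\<langle>w2, w2\<rangle> = r \<odot> h"
    using bracket_multiple_of_h by metis
  show thesis
  proof (cases "p = 0")
    case True
    then show ?thesis using that w pqr by simp
  next
    case False
    define s where "s = csqrt (q\<^sup>2 - p * r)"
    define t where "t = (- q + s) / p"
    have "p * (p * t\<^sup>2 + 2 * q * t + r) = (p * t + q)\<^sup>2 - (q\<^sup>2 - p * r)"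
      by (simp add: power2_eq_square algebra_simps)
    also have "\<dots> = 0" using False by (simp add: t_def s_def)
    finally have root: "p * t\<^sup>2 + 2 * q * t + r = 0" using False by simp
    let ?v = "t \<odot> w1 + w2"
    have w21: "\<langle>w2, w1\<rangle> = q \<odot> h"
      using bracket_odd_commute[OF w(1,3)] pqr(2) by simp
    have "\<langle>?v, ?v\<rangle> = (t * (t * p) + t * q + (t * q + r)) \<odot> h"
      unfolding scale_left_distrib
      by (simp add: bracket_simps pqr w21 scale_right_distrib add_ac)
    also have "t * (t * p) + t * q + (t * q + r) = 0" using root by algebra
    finally have "\<langle>?v, ?v\<rangle> = 0" by simp
    moreover have "?v \<noteq> 0"
      using w(4)[of "- t"] by (metis add.commute eq_neg_iff_add_eq_0 scale_minus_left)
    moreover have "?v \<in> odd_part"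
      by (intro subspace_add[OF subspace_grading] subspace_scale[OF subspace_grading] w)
    ultimately show ?thesis using that by blast
  qed
qed

text \<open>
  An isotropic vector \<open>v\<close> has a partner \<open>y\<close> with \<open>[v, y] = h\<close>. Adding a multiple of \<open>v\<close> to \<open>y\<close>
  keeps this bracket and makes the partner isotropic.
\<close>
lemma hyperbolic_pair:
  assumes h: "h \<in> even_part"
  obtains v w where "v \<in> odd_part" "w \<in> odd_part" "\<langle>v, v\<rangle> = 0" "\<langle>w, w\<rangle> = 0" "\<langle>v, w\<rangle> = h"
proof -
  obtain v where v: "v \<in> odd_part" "v \<noteq> 0" "\<langle>v, v\<rangle> = 0"
    using isotropic_odd_vector[OF h] by blast
  obtain y where y: "y \<in> odd_part" "\<langle>v, y\<rangle> = h" using odd_pairing[OF h v(1,2)] by blast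
  obtain e where e: "\<langle>y, y\<rangle> = e \<odot> h" by (rule bracket_multiple_of_h)
  have y': "\<langle>y, v\<rangle> = h" using bracket_odd_commute[OF y(1) v(1)] y(2) by simp
  obtain t where t: "e + t + t = 0"
    by (rule that[of "- e / 2"]) simp
  let ?w = "y + t \<odot> v"
  have "\<langle>?w, ?w\<rangle> = (e + t + t) \<odot> h"
    unfolding scale_left_distrib by (simp add: bracket_simps v y y' e)
  then have "\<langle>?w, ?w\<rangle> = 0" by (simp add: t)
  moreover have "\<langle>v, ?w\<rangle> = h" by (simp add: bracket_simps v y)
  moreover have "?w \<in> odd_part"
    by (intro subspace_add[OF subspace_grading] subspace_scale[OF subspace_grading] v y)
  ultimately show thesis using that v by blast
qed

lemma bij_hyperbolic:
  assumes h: "h \<in> even_part"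
    and "v \<in> odd_part" "w \<in> odd_part" "\<langle>v, v\<rangle> = 0" "\<langle>w, w\<rangle> = 0" "\<langle>v, w\<rangle> = h"
  shows "bij (lincomb3 h v w)"
proof (rule bij_lincomb3)
  fix a b c assume eq: "a \<odot> h + b \<odot> v + c \<odot> w = 0"
  have "\<langle>a \<odot> h + b \<odot> v + c \<odot> w, w\<rangle> = b \<odot> h"
    by (simp add: bracket_simps assms bracket_h_left)
  moreover have "\<langle>v, a \<odot> h + b \<odot> v + c \<odot> w\<rangle> = c \<odot> h"
    using central_left_imp_right[OF bracket_h_left h] by (simp add: bracket_simps assms)
  ultimately have "b = 0" "c = 0"
    unfolding eq by (simp_all add: bracket_simps h_nonzero)
  then show "a = 0 \<and> b = 0 \<and> c = 0" using eq h_nonzero by simp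
qed

text \<open>
  Applying the twist to \<open>[v, v] = [w, w] = 0\<close> shows that in each column of its matrix on the odd part
  one entry is zero. The zero entries lie in different rows (a diagonal or an antidiagonal matrix)
  or in the same row, in which case the determinant and the eigenvalue on \<open>h\<close> vanish.
\<close>
lemma classification_even_center:
  assumes h: "h \<in> even_part"
  shows
    "(\<exists>\<mu>11 \<mu>22. \<mu>11 * \<mu>22 \<noteq> 0 \<and>
        hls_isomorphic g (h1 (mat3 (\<mu>11 * \<mu>22) 0 0  0 \<mu>11 0  0 0 \<mu>22))) \<or>
     (\<exists>\<mu>12 \<mu>21. \<mu>12 * \<mu>21 \<noteq> 0 \<and>
        hls_isomorphic g (h1 (mat3 (\<mu>12 * \<mu>21) 0 0  0 0 \<mu>12  0 \<mu>21 0))) \<or>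
     (\<exists>\<mu>11 \<mu>12. hls_isomorphic g (h1 (mat3 0 0 0  0 \<mu>11 \<mu>12  0 0 0)))"
proof -
  obtain v w where vw: "v \<in> odd_part" "w \<in> odd_part" "\<langle>v, v\<rangle> = 0" "\<langle>w, w\<rangle> = 0" "\<langle>v, w\<rangle> = h"
    using hyperbolic_pair[OF h] by blast
  have wv: "\<langle>w, v\<rangle> = h" using bracket_odd_commute[OF vw(1,2)] vw(5) by simp
  have bij: "bij (lincomb3 h v w)" by (rule bij_hyperbolic[OF h vw])
  have bij': "bij (lincomb3 h w v)" by (rule bij_hyperbolic[OF h vw(2,1,4,3) wv])
  obtain a c where tv: "twist g v = a \<odot> v + c \<odot> w"
    using odd_expansion[OF bij h vw(1,2) twist_grading[OF vw(1)]] by blast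
  obtain b d where tw: "twist g w = b \<odot> v + d \<odot> w"
    using odd_expansion[OF bij h vw(1,2) twist_grading[OF vw(2)]] by blast
  have pair: "\<langle>p \<odot> v + q \<odot> w, p' \<odot> v + q' \<odot> w\<rangle> = (p * q' + q * p') \<odot> h" for p q p' q'
    by (simp add: bracket_simps vw wv scale_left_distrib algebra_simps)
  have "a * c + c * a = 0"
    using twist_bracket[of v v] h_nonzero by (simp add: tv pair vw tw.zero)
  then have ac: "a * c = 0" by (simp add: mult.commute)
  have "b * d + d * b = 0"
    using twist_bracket[of w w] h_nonzero by (simp add: tw pair vw tw.zero)
  then have bd: "b * d = 0" by (simp add: mult.commute)
  have th: "twist g h = (a * d + c * b) \<odot> h"
    using twist_bracket[of v w] by (simp add: tv tw pair vw)
  have iso: "hls_isomorphic g (h1 (mat3 (a * d + c * b) 0 0  0 a b  0 c d))"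
    by (rule isomorphic_to_h1[OF h vw(1,2) bij vw(3-5) th tv tw])
  \<comment> \<open>The same twist in the basis with \<open>v\<close> and \<open>w\<close> exchanged.\<close>
  have iso': "hls_isomorphic g (h1 (mat3 (a * d + c * b) 0 0  0 d c  0 b a))"
    by (rule isomorphic_to_h1[OF h vw(2,1) bij' vw(4,3) wv th]) (simp_all add: tv tw add.commute)
  \<comment> \<open>Singular diagonal and antidiagonal matrices are subsumed under the last two cases.\<close>
  consider "c = 0" "b = 0" "a * d \<noteq> 0" | "a = 0" "d = 0" "b * c \<noteq> 0" | "c = 0" "d = 0" | "a = 0" "b = 0"
    using ac bd by auto
  then show ?thesis
  proof cases
    case 1
    then show ?thesis using iso by auto
  next
    case 2
    then show ?thesis using iso by (auto simp: mult.commute)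
  next
    case 3
    then show ?thesis using iso by auto
  next
    case 4
    then show ?thesis using iso' by auto
  qed
qed

section \<open>Odd central generator\<close>

text \<open>
  Brackets of vectors of equal parity are even and therefore zero, so a nonzero bracket must
  come from an even and an odd component.
\<close>
lemma even_odd_pair:
  assumes h: "h \<in> odd_part"
  obtains u v where "u \<in> even_part" "v \<in> odd_part" "\<langle>u, v\<rangle> = h"
proof -
  obtain x y where xy: "\<langle>x, y\<rangle> \<noteq> 0" using nonzero_bracket by blast
  obtain x0 x1 where x: "x0 \<in> even_part" "x1 \<in> odd_part" "x = x0 + x1"
    by (rule homogeneous_decomposition)
  obtain y0 y1 where y: "y0 \<in> even_part" "y1 \<in> odd_part" "y = y0 + y1"
    by (rule homogeneous_decomposition)
  have "\<langle>x0, y0\<rangle> = 0" "\<langle>x1, y1\<rangle> = 0"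
    using bracket_wrong_parity[OF h x(1) y(1)] bracket_wrong_parity[OF h x(2) y(2)] by simp_all
  then have "\<langle>x, y\<rangle> = \<langle>x0, y1\<rangle> - \<langle>y0, x1\<rangle>"
    using bracket_even_anticommute[OF y(1) x(2)] by (simp add: x(3) y(3) bracket_simps)
  then consider "\<langle>x0, y1\<rangle> \<noteq> 0" | "\<langle>y0, x1\<rangle> \<noteq> 0"
    using xy by (cases "\<langle>x0, y1\<rangle> = 0") auto
  then show thesis
  proof cases
    case 1
    then show ?thesis using bracket_normalise[OF _ y(2)] x(1) that by blast
  next
    case 2
    then show ?thesis using bracket_normalise[OF _ x(2)] y(1) that by blast
  qed
qed

text \<open>
  The factor \<open>k\<close> accommodates a rescaled even vector, whose bracket with \<open>v\<close> is a multiple of \<open>h\<close>.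
\<close>
lemma bij_even_odd_pair:
  assumes h: "h \<in> odd_part" and uv: "u \<in> even_part" "v \<in> odd_part" "\<langle>u, v\<rangle> = k \<odot> h" "k \<noteq> 0"
  shows "bij (lincomb3 u v (k \<odot> h))"
proof (rule bij_lincomb3)
  fix a b c assume eq: "a \<odot> u + b \<odot> v + c \<odot> k \<odot> h = 0"
  have z: "\<langle>u, u\<rangle> = 0" "\<langle>u, h\<rangle> = 0" "\<langle>v, v\<rangle> = 0" "\<langle>h, v\<rangle> = 0"
    using bracket_even_self[OF uv(1)] central_left_imp_right[OF bracket_h_left h]
      bracket_wrong_parity[OF h uv(2,2)] bracket_h_left by auto
  have "\<langle>u, a \<odot> u + b \<odot> v + c \<odot> k \<odot> h\<rangle> = (b * k) \<odot> h"
    by (simp add: bracket_simps uv z)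
  moreover have "\<langle>a \<odot> u + b \<odot> v + c \<odot> k \<odot> h, v\<rangle> = (a * k) \<odot> h"
    by (simp add: bracket_simps uv z)
  ultimately have "a = 0" "b = 0"
    unfolding eq using uv(4) by (simp_all add: bracket_simps h_nonzero)
  then show "a = 0 \<and> b = 0 \<and> c = 0" using eq h_nonzero uv(4) by simp
qed

text \<open>
  The only freedom beyond scaling is \<open>v \<mapsto> v + t h\<close>, which shifts the off-diagonal entry \<open>b\<close> by
  \<open>t (m - 1) a\<close>.
\<close>
lemma classification_odd_center:
  assumes h: "h \<in> odd_part"
  shows
    "(\<exists>\<mu>0 \<mu>11. hls_isomorphic g (h2 (mat3 \<mu>0 0 0  0 \<mu>11 0  0 0 (\<mu>0 * \<mu>11)))) \<or>
     (\<exists>\<mu>0 \<mu>11. (\<mu>0 - 1) * \<mu>11 = 0 \<and>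
        hls_isomorphic g (h2 (mat3 \<mu>0 0 0  0 \<mu>11 0  0 1 \<mu>11)))"
proof -
  obtain u v where uv: "u \<in> even_part" "v \<in> odd_part" "\<langle>u, v\<rangle> = h"
    using even_odd_pair[OF h] by blast
  have bij: "bij (lincomb3 u v h)" using bij_even_odd_pair[OF h uv(1,2), of 1] uv(3) by simp
  obtain m where tu: "twist g u = m \<odot> u"
    using even_expansion[OF bij uv(1,2) h twist_grading[OF uv(1)]] by blast
  obtain a b where tv: "twist g v = a \<odot> v + b \<odot> h"
    using odd_expansion[OF bij uv(1,2) h twist_grading[OF uv(2)]] by blast
  have right: "\<langle>y, h\<rangle> = 0" for y by (rule central_left_imp_right[OF bracket_h_left h])
  have th: "twist g h = (m * a) \<odot> h"
    using twist_bracket[of u v] by (simp add: tu tv uv bracket_simps right)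
  have vv: "\<langle>y, y\<rangle> = 0" if "y \<in> odd_part" for y
    using bracket_wrong_parity[OF h that that] by simp
  show ?thesis
  proof (cases "b = 0 \<or> (m - 1) * a \<noteq> 0")
    case True
    \<comment> \<open>If the denominator is zero, then \<open>b = 0\<close> and \<open>t = 0\<close>, and \<open>v\<close> stays unchanged.\<close>
    define t where "t = - b / ((m - 1) * a)"
    have t: "b + t * ((m - 1) * a) = 0" using True by (auto simp: t_def)
    let ?v = "v + t \<odot> h"
    have odd: "?v \<in> odd_part"
      by (intro subspace_add[OF subspace_grading] subspace_scale[OF subspace_grading] uv h)
    have br: "\<langle>u, ?v\<rangle> = h" by (simp add: bracket_simps uv right)
    have bij': "bij (lincomb3 u ?v h)"
      using bij_even_odd_pair[OF h uv(1) odd, of 1] br by simp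
    have "twist g ?v = a \<odot> v + (b + t * (m * a)) \<odot> h"
      by (simp add: tw.add tw.scale tv th scale_left_distrib algebra_simps)
    also have "b + t * (m * a) = a * t" using t by algebra
    also have "a \<odot> v + (a * t) \<odot> h = a \<odot> ?v + 0 \<odot> h" by (simp add: scale_right_distrib)
    finally have "twist g ?v = a \<odot> ?v + 0 \<odot> h" .
    then have "hls_isomorphic g (h2 (mat3 m 0 0  0 a 0  0 0 (m * a)))"
      by (rule isomorphic_to_h2[OF uv(1) odd h bij' br vv[OF odd] bracket_h_left tu _ th])
    then show ?thesis by blast
  next
    case False
    then have b: "b \<noteq> 0" and ma: "(m - 1) * a = 0" by auto
    have even: "b \<odot> u \<in> even_part" by (rule subspace_scale[OF subspace_grading uv(1)])
    have odd: "b \<odot> h \<in> odd_part" by (rule subspace_scale[OF subspace_grading h])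
    have br: "\<langle>b \<odot> u, v\<rangle> = b \<odot> h" by (simp add: bracket_simps uv)
    have "hls_isomorphic g (h2 (mat3 m 0 0  0 a 0  0 1 a))"
    proof (rule isomorphic_to_h2[OF even uv(2) odd
          bij_even_odd_pair[OF h even uv(2) br b] br vv[OF uv(2)]])
      show "\<langle>b \<odot> h, y\<rangle> = 0" for y by (simp add: bracket_simps bracket_h_left)
      show "twist g (b \<odot> u) = m \<odot> b \<odot> u" by (simp add: tw.scale tu mult.commute)
      show "twist g v = a \<odot> v + 1 \<odot> b \<odot> h" by (simp add: tv)
      have "m * a = a" using ma by algebra
      then show "twist g (b \<odot> h) = a \<odot> b \<odot> h" by (simp add: tw.scale th mult.commute)
    qed
    then show ?thesis using ma by blast
  qed
qed

end

section \<open>The classification\<close>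

lemma one_dimensional_center_eq_span:
  fixes g :: "'a::ab_group_add hom_superalgebra"
  assumes hls: "hom_lie_superalgebra g"
    and fin: "\<exists>B. finite B \<and> module.span (scaling g) B = UNIV"
    and dim: "vector_space.dim (scaling g) (hls_center g) = 1"
    and h: "h \<in> hls_center g" "h \<noteq> 0"
  shows "hls_center g = module.span (scaling g) {h}"
proof -
  interpret vector_space "scaling g"
    using hls unfolding hom_lie_superalgebra_def super_vector_space_def by blast
  obtain B where "finite_dimensional_vector_space (scaling g) B"
    using finite_spanning_imp_finite_dimensional fin by blast
  then interpret V: finite_dimensional_vector_space "scaling g" B .
  have lin: "Vector_Spaces.linear (scaling g) (scaling g) (\<lambda>x. bracket g x y)" for y
    using hls unfolding hom_lie_superalgebra_def by blast
  have "bracket g 0 y = 0" for y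
    using module_hom.zero[OF lin[unfolded linear_iff_module_hom]] by simp
  then have "subspace (hls_center g)"
    using lin by (auto simp: subspace_def hls_center_def Vector_Spaces.linear_iff)
  moreover have "hls_center g \<subseteq> span {h}"
    by (rule V.card_ge_dim_independent) (use h dim in auto)
  ultimately show ?thesis using h(1) span_minimal[of "{h}" "hls_center g"] by blast
qed

theorem theorem3p2:
  fixes g :: "'a::ab_group_add hom_superalgebra"
  assumes "heisenberg_hom_lie_superalgebra g"
    and "multiplicative g"
    and "vector_space.dim (scaling g) (UNIV :: 'a set) = 3"
    and "grading g 1 \<noteq> {0}"
    and one_dimensional_center: "vector_space.dim (scaling g) (hls_center g) = 1"
  shows
    "(\<exists>\<mu>11 \<mu>22. \<mu>11 * \<mu>22 \<noteq> 0 \<and>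
        hls_isomorphic g (h1 (mat3 (\<mu>11 * \<mu>22) 0   0
                                   0           \<mu>11 0
                                   0           0   \<mu>22))) \<or>
     (\<exists>\<mu>12 \<mu>21. \<mu>12 * \<mu>21 \<noteq> 0 \<and>
        hls_isomorphic g (h1 (mat3 (\<mu>12 * \<mu>21) 0   0
                                   0           0   \<mu>12
                                   0           \<mu>21 0))) \<or>
     (\<exists>\<mu>11 \<mu>12.
        hls_isomorphic g (h1 (mat3 0 0   0
                                   0 \<mu>11 \<mu>12
                                   0 0   0))) \<or>
     (\<exists>\<mu>0 \<mu>11.
        hls_isomorphic g (h2 (mat3 \<mu>0 0   0
                                   0  \<mu>11 0
                                   0  0   (\<mu>0 * \<mu>11)))) \<or>
     (\<exists>\<mu>0 \<mu>11. (\<mu>0 - 1) * \<mu>11 = 0 \<and>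
        hls_isomorphic g (h2 (mat3 \<mu>0 0   0
                                   0  \<mu>11 0
                                   0  1   \<mu>11)))"
proof -
  obtain h i where h: "h \<noteq> 0" "h \<in> grading g i" "h \<in> hls_center g"
      "derived_ideal g = module.span (scaling g) {h}"
    and g: "hom_lie_superalgebra g" "\<exists>B. finite B \<and> module.span (scaling g) B = UNIV"
    using assms(1) by (auto simp: heisenberg_hom_lie_superalgebra_def)
  interpret heisenberg_superalgebra_dim3 g h
    using assms g h one_dimensional_center_eq_span[OF g one_dimensional_center h(3,1)]
    by unfold_locales auto
  show ?thesis
  proof (cases "i = 0")
    case True
    then show ?thesis using classification_even_center h(2) by blast
  next
    case False
    then have "h \<in> odd_part" using h(2) by simp
    then show ?thesis using classification_odd_center by blast
  qed
qed

end
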